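(* For nested convex body chasing in $\mathbb{R}^d$ with the Euclidean norm, the greedy algorithm, which at each time $t$ outputs $x_t=\mathrm{proj}_{K_t}(x_{t-1})$ (the point of $K_t$ closest to $x_{t-1}$ in Euclidean distance), is $O(d^{(d+1)/2})$-competitive.
   Context: Nested convex body chasing: an online algorithm is given a starting point $x_0\in\mathbb{R}^d$ and then, one at a time, convex bodies $K_1\supseteq K_2\supseteq\cdots$ in $\mathbb{R}^d$; upon receiving $K_t$ (before seeing $K_{t+1}$) it outputs a point $x_t\in K_t$. Its cost on $K_1,\dots,K_T$ is $\sum_{t=1}^T\|x_t-x_{t-1}\|_2$, and the optimal offline cost is $\min_{x\in K_T}\|x_0-x\|_2$. An algorithm is $c$-competitive if its cost is always at most $c$ times the optimal offline cost. *)

theory Defs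
  imports "HOL-Analysis.Analysis" "HOL-Library.Landau_Symbols"
begin

text \<open>
  The bound is uniform in the dimension, so the dimension \<open>d\<close> is a natural number rather than a
  type: \<open>\<real>\<^sup>d\<close> is the library space \<open>Euclidean_space d\<close>, whose points are the sequences
  \<open>x :: nat \<Rightarrow> real\<close> with \<open>x i = 0\<close> for all \<open>i \<ge> d\<close>.
\<close>

type_synonym point = "nat \<Rightarrow> real"

definition edist :: "nat \<Rightarrow> point \<Rightarrow> point \<Rightarrow> real" where
  "edist d x y = L2_set (\<lambda>i. x i - y i) {..<d}"

definition convex_set :: "point set \<Rightarrow> bool" where
  "convex_set K \<longleftrightarrow>
     (\<forall>x\<in>K. \<forall>y\<in>K. \<forall>u\<ge>0. \<forall>v\<ge>0. u + v = 1 \<longrightarrow> (\<lambda>i. u * x i + v * y i) \<in> K)"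

text \<open>
  As usual in convex body chasing, requests are only required to be nonempty, closed and convex;
  compact bodies and bodies with nonempty interior are special cases.
\<close>

definition convex_body :: "nat \<Rightarrow> point set \<Rightarrow> bool" where
  "convex_body d K \<longleftrightarrow> K \<noteq> {} \<and> closedin (Euclidean_space d) K \<and> convex_set K"

definition nested_instance :: "nat \<Rightarrow> point set list \<Rightarrow> bool" where
  "nested_instance d Ks \<longleftrightarrow>
     Ks \<noteq> [] \<and> (\<forall>K\<in>set Ks. convex_body d K) \<and> sorted_wrt (\<supseteq>) Ks"

text \<open>
  An online algorithm maps the starting point and the requests \<open>[K\<^sub>1, \<dots>, K\<^sub>t]\<close> seen so far to \<open>x\<^sub>t\<close>.
\<close>

type_synonym algorithm = "point \<Rightarrow> point set list \<Rightarrow> point"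

definition position :: "algorithm \<Rightarrow> point \<Rightarrow> point set list \<Rightarrow> nat \<Rightarrow> point" where
  "position A x0 Ks t = (if t = 0 then x0 else A x0 (take t Ks))"

definition cost :: "nat \<Rightarrow> algorithm \<Rightarrow> point \<Rightarrow> point set list \<Rightarrow> real" where
  "cost d A x0 Ks =
     (\<Sum>t=1..length Ks. edist d (position A x0 Ks t) (position A x0 Ks (t - 1)))"

text \<open>The infimum is attained, since \<open>K\<^sub>T\<close> is closed and nonempty.\<close>

definition opt_cost :: "nat \<Rightarrow> point \<Rightarrow> point set list \<Rightarrow> real" where
  "opt_cost d x0 Ks = (INF x\<in>last Ks. edist d x0 x)"

definition competitive :: "nat \<Rightarrow> real \<Rightarrow> algorithm \<Rightarrow> bool" where
  "competitive d c A \<longleftrightarrow>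
     (\<forall>x0 \<in> topspace (Euclidean_space d). \<forall>Ks. nested_instance d Ks \<longrightarrow>
        (\<forall>t\<in>{1..length Ks}. position A x0 Ks t \<in> Ks ! (t - 1)) \<and>
        cost d A x0 Ks \<le> c * opt_cost d x0 Ks)"

definition proj :: "nat \<Rightarrow> point set \<Rightarrow> point \<Rightarrow> point" where
  "proj d K x = arg_min_on (edist d x) K"

definition greedy :: "nat \<Rightarrow> algorithm" where
  "greedy d x0 Ks = foldl (\<lambda>x K. proj d K x) x0 Ks"

end

theory Submission
  imports Defs
begin

text \<open>
  Every greedy step ends at a nearest point, so from \<open>x\<^sub>k\<close> the directions to all later points,
  together with the direction of the last step, are pairwise at angle at most \<open>\<pi>/2\<close>. Hence some
  unit vector \<open>\<xi>\<close> makes an inner product of at least \<open>1 / sqrt d\<close> with each of the corresponding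
  unit vectors, and the ball of radius \<open>1 / sqrt d\<close> around \<open>\<xi>\<close> lies in their dual cone.
  For \<open>\<eta>\<close> in that cone, the minimum of \<open>\<langle>\<eta>, x\<^sub>u\<rangle>\<close> over \<open>u \<ge> k\<close> is attained at \<open>u = k\<close>, so the
  step raises it by at least \<open>\<langle>\<eta>, x\<^sub>k - x\<^sub>k\<^sub>-\<^sub>1\<rangle>\<close>; for other \<open>\<eta>\<close> it does not decrease.
  Integrating over \<open>\<eta>\<close> in the origin-centred ball of squared radius \<open>1 + 5 / d\<close> (a variant of the
  mean-width argument of Manselli and Pucci) and telescoping bounds the length of the path by
  \<open>O(d powr ((d + 1) / 2))\<close> times its end-to-end distance, which is at most twice the optimal
  cost. This larger ball contains a symmetric part, of at least half the volume, of the small ball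
  around \<open>\<xi>\<close>, so only the ratio of the two radii enters the bound.
\<close>

section \<open>Inner products on coordinate sequences\<close>

definition ip :: "nat \<Rightarrow> point \<Rightarrow> point \<Rightarrow> real" where
  "ip d x y = (\<Sum>i<d. x i * y i)"

definition nrm :: "nat \<Rightarrow> point \<Rightarrow> real" where
  "nrm d x = L2_set x {..<d}"

lemma nrm_square: "(nrm d x)\<^sup>2 = ip d x x"
  by (simp add: nrm_def ip_def L2_set_def sum_nonneg power2_eq_square)

lemma nrm_nonneg [simp]: "0 \<le> nrm d x"
  by (simp add: nrm_def)

lemma nrm_eq_sqrt: "nrm d x = sqrt (ip d x x)"
  by (simp flip: nrm_square)

lemma edist_eq_nrm: "edist d x y = nrm d (\<lambda>i. x i - y i)"
  by (simp add: edist_def nrm_def)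

lemma edist_commute: "edist d x y = edist d y x"
  by (simp add: edist_def L2_set_def power2_commute)

lemma edist_triangle: "edist d x z \<le> edist d x y + edist d y z"
  using L2_set_triangle_ineq[of "\<lambda>i. x i - y i" "\<lambda>i. y i - z i" "{..<d}"]
  by (simp add: edist_def)

lemma ip_commute: "ip d x y = ip d y x"
  by (simp add: ip_def mult.commute)

lemma ip_add_left: "ip d (\<lambda>i. x i + y i) z = ip d x z + ip d y z"
  by (simp add: ip_def algebra_simps sum.distrib)

lemma ip_add_right: "ip d z (\<lambda>i. x i + y i) = ip d z x + ip d z y"
  by (simp add: ip_def algebra_simps sum.distrib)

lemma ip_diff_left: "ip d (\<lambda>i. x i - y i) z = ip d x z - ip d y z"
  by (simp add: ip_def algebra_simps sum_subtractf)

lemma ip_diff_right: "ip d z (\<lambda>i. x i - y i) = ip d z x - ip d z y"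
  by (simp add: ip_def algebra_simps sum_subtractf)

lemma ip_scale_left: "ip d (\<lambda>i. c * x i) z = c * ip d x z"
  by (simp add: ip_def sum_distrib_left mult_ac)

lemma ip_scale_right: "ip d z (\<lambda>i. c * x i) = c * ip d z x"
  by (simp add: ip_def sum_distrib_left mult_ac)

lemma ip_minus_left: "ip d (\<lambda>i. - x i) z = - ip d x z"
  by (simp add: ip_def sum_negf)

lemma ip_sum_left: "ip d (\<lambda>k. \<Sum>i\<in>I. c i * p i k) z = (\<Sum>i\<in>I. c i * ip d (p i) z)"
proof -
  have "ip d (\<lambda>k. \<Sum>i\<in>I. c i * p i k) z = (\<Sum>k<d. \<Sum>i\<in>I. c i * (p i k * z k))"
    by (simp add: ip_def sum_distrib_right mult.assoc)
  also have "\<dots> = (\<Sum>i\<in>I. \<Sum>k<d. c i * (p i k * z k))"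
    by (rule sum.swap)
  finally show ?thesis
    by (simp add: ip_def sum_distrib_left)
qed

lemmas ip_linear = ip_add_left ip_add_right ip_diff_left ip_diff_right ip_scale_left
  ip_scale_right ip_minus_left

lemma nrm_scale: "nrm d (\<lambda>i. c * x i) = \<bar>c\<bar> * nrm d x"
  by (simp add: nrm_eq_sqrt ip_scale_left ip_scale_right real_sqrt_mult flip: mult.assoc)

lemma ip_nonneg: "0 \<le> ip d x x"
  by (simp flip: nrm_square)

lemma abs_ip_le: "\<bar>ip d x y\<bar> \<le> nrm d x * nrm d y"
proof -
  have "\<bar>ip d x y\<bar> \<le> (\<Sum>i<d. \<bar>x i\<bar> * \<bar>y i\<bar>)"
    unfolding ip_def by (rule order_trans[OF sum_abs]) (simp add: abs_mult)
  also have "\<dots> \<le> nrm d x * nrm d y"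
    unfolding nrm_def by (rule L2_set_mult_ineq)
  finally show ?thesis .
qed

lemma edist_square: "(edist d x y)\<^sup>2 = ip d x x - 2 * ip d x y + ip d y y"
  by (simp add: edist_eq_nrm nrm_square ip_linear ip_commute[of d y x])

text \<open>First-order optimality: if <x,y> < 0, then |x + t y|^2 - |x|^2 = t (2 <x,y> + t |y|^2)
  is negative for small t. It serves both the minimal-norm hull point and the projections.\<close>

lemma ip_nonneg_if_norm_minimal:
  assumes "\<And>t. \<lbrakk>0 < t; t \<le> 1\<rbrakk> \<Longrightarrow> nrm d x \<le> nrm d (\<lambda>i. x i + t * y i)"
  shows "0 \<le> ip d x y"
proof (rule ccontr)
  assume neg: "\<not> 0 \<le> ip d x y"
  \<comment> \<open>The summand 1 keeps the denominator positive when y has norm zero.\<close>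
  define t where "t = min 1 (- ip d x y / (ip d y y + 1))"
  have pos: "ip d y y + 1 > 0"
    using ip_nonneg[of d y] by simp
  have t: "0 < t" "t \<le> 1"
    using neg pos by (auto simp: t_def divide_neg_pos)
  have "t \<le> - ip d x y / (ip d y y + 1)"
    by (simp add: t_def)
  then have "t * (ip d y y + 1) \<le> - ip d x y"
    by (subst (asm) pos_le_divide_eq[OF pos])
  then have "t * ip d y y < - ip d x y"
    using t by (simp add: algebra_simps)
  then have "2 * ip d x y + t * ip d y y < 0"
    using neg by simp
  then have "t * (2 * ip d x y + t * ip d y y) < 0"
    using t(1) by (simp add: mult_pos_neg)
  moreover have "(nrm d x)\<^sup>2 \<le> (nrm d (\<lambda>i. x i + t * y i))\<^sup>2"
    using assms[OF t] by (simp add: power_mono)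
  ultimately show False
    by (simp add: nrm_square ip_linear ip_commute[of d y x] algebra_simps)
qed

text \<open>Tychonoff. Coordinates with equal bounds are pinned, so finite-dimensional simplices and
  boxes embed as compact sets of functions.\<close>

lemma compact_box:
  fixes a b :: "'i \<Rightarrow> real"
  shows "compact {x. \<forall>i. a i \<le> x i \<and> x i \<le> b i}"
proof -
  have "compactin (product_topology (\<lambda>i. euclidean) UNIV) (PiE UNIV (\<lambda>i. {a i..b i}))"
    by (simp add: compactin_PiE)
  moreover have "PiE UNIV (\<lambda>i. {a i..b i}) = {x. \<forall>i. a i \<le> x i \<and> x i \<le> b i}"
    by (auto simp: PiE_def Pi_def)
  ultimately show ?thesis
    by (simp add: euclidean_product_topology compactin_euclidean_iff)
qed

lemma continuous_on_ip [continuous_intros]: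
  assumes "\<And>i. i < d \<Longrightarrow> continuous_on S (\<lambda>x. f x i)" "\<And>i. i < d \<Longrightarrow> continuous_on S (\<lambda>x. g x i)"
  shows "continuous_on S (\<lambda>x. ip d (f x) (g x))"
  unfolding ip_def using assms by (intro continuous_intros) auto

lemma continuous_on_nrm [continuous_intros]:
  assumes "\<And>i. i < d \<Longrightarrow> continuous_on S (\<lambda>x. f x i)"
  shows "continuous_on S (\<lambda>x. nrm d (f x))"
  unfolding nrm_eq_sqrt using assms by (intro continuous_intros)

section \<open>Pairwise acute families of vectors\<close>

text \<open>
  Let \<open>A = \<Sum>i. c i * p i p i\<^sup>T\<close>. As \<open>0 \<le> \<langle>p i, p j\<rangle> \<le> 1\<close>, the squared norm of the combination
  dominates \<open>tr (A\<^sup>2) \<ge> (tr A)\<^sup>2 / d = 1 / d\<close>.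
\<close>

lemma acute_combination_norm_ge:
  assumes "finite I" and "\<And>i. i \<in> I \<Longrightarrow> 0 \<le> c i" and "sum c I = 1"
    and unit: "\<And>i. i \<in> I \<Longrightarrow> nrm d (p i) = 1"
    and acute: "\<And>i j. \<lbrakk>i \<in> I; j \<in> I\<rbrakk> \<Longrightarrow> 0 \<le> ip d (p i) (p j)"
  shows "1 \<le> real d * (nrm d (\<lambda>k. \<Sum>i\<in>I. c i * p i k))\<^sup>2"
proof -
  define A where "A k l = (\<Sum>i\<in>I. c i * (p i k * p i l))" for k l
  have ip1: "ip d (p i) (p i) = 1" if "i \<in> I" for i
    using unit[OF that] by (simp flip: nrm_square)
  have "(\<Sum>k<d. A k k) = (\<Sum>i\<in>I. \<Sum>k<d. c i * (p i k * p i k))"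
    unfolding A_def by (rule sum.swap)
  also have "\<dots> = (\<Sum>i\<in>I. c i * ip d (p i) (p i))"
    by (simp add: ip_def sum_distrib_left)
  also have "\<dots> = 1"
    using assms(3) by (simp add: ip1)
  finally have trace: "(\<Sum>k<d. A k k) = 1" .
  \<comment> \<open>Cauchy-Schwarz on the diagonal of A; adding the off-diagonal squares then gives
    tr (A^2), as A is symmetric.\<close>
  have "1 \<le> real d * (\<Sum>k<d. (A k k)\<^sup>2)"
    using sum_squared_le_sum_of_squares[of "\<lambda>k. A k k" "{..<d}"] trace by (simp add: mult.commute)
  also have "\<dots> \<le> real d * (\<Sum>k<d. \<Sum>l<d. (A k l)\<^sup>2)"
    by (intro mult_left_mono sum_mono member_le_sum[where f = "\<lambda>l. (A _ l)\<^sup>2"]) auto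
  also have "(\<Sum>k<d. \<Sum>l<d. (A k l)\<^sup>2) = (\<Sum>i\<in>I. \<Sum>j\<in>I. c i * c j * (ip d (p i) (p j))\<^sup>2)"
  proof -
    have "(\<Sum>k<d. \<Sum>l<d. (A k l)\<^sup>2)
        = (\<Sum>k<d. \<Sum>l<d. \<Sum>i\<in>I. \<Sum>j\<in>I. c i * c j * ((p i k * p j k) * (p i l * p j l)))"
      by (simp add: A_def power2_eq_square sum_product mult_ac)
    also have "\<dots> = (\<Sum>k<d. \<Sum>i\<in>I. \<Sum>l<d. \<Sum>j\<in>I. c i * c j * ((p i k * p j k) * (p i l * p j l)))"
      by (rule sum.cong[OF refl], rule sum.swap)
    also have "\<dots> = (\<Sum>i\<in>I. \<Sum>k<d. \<Sum>j\<in>I. \<Sum>l<d. c i * c j * ((p i k * p j k) * (p i l * p j l)))"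
      by (subst sum.swap, intro sum.cong refl, rule sum.swap)
    also have "\<dots> = (\<Sum>i\<in>I. \<Sum>j\<in>I. \<Sum>k<d. \<Sum>l<d. c i * c j * ((p i k * p j k) * (p i l * p j l)))"
      by (rule sum.cong[OF refl], rule sum.swap)
    also have "\<dots> = (\<Sum>i\<in>I. \<Sum>j\<in>I. c i * c j * (ip d (p i) (p j))\<^sup>2)"
      unfolding ip_def power2_eq_square sum_product unfolding sum_distrib_left by (rule refl)
    finally show ?thesis .
  qed
  also have "\<dots> \<le> (\<Sum>i\<in>I. \<Sum>j\<in>I. c i * c j * ip d (p i) (p j))"
  proof (intro sum_mono mult_left_mono)
    fix i j assume ij: "i \<in> I" "j \<in> I"
    have "ip d (p i) (p j) \<le> 1"
      using abs_ip_le[of d "p i" "p j"] unit[OF ij(1)] unit[OF ij(2)] by simp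
    then show "(ip d (p i) (p j))\<^sup>2 \<le> ip d (p i) (p j)"
      using acute[OF ij] by (simp add: power2_eq_square mult_left_le)
  qed (use assms in auto)
  also have "\<dots> = (nrm d (\<lambda>k. \<Sum>i\<in>I. c i * p i k))\<^sup>2"
  proof -
    define v where "v = (\<lambda>k. \<Sum>i\<in>I. c i * p i k)"
    have "ip d v v = (\<Sum>i\<in>I. c i * ip d v (p i))"
      unfolding v_def ip_sum_left[of d c p I "\<lambda>k. \<Sum>i\<in>I. c i * p i k"]
      by (intro sum.cong arg_cong2[where f = "(*)"] refl ip_commute)
    also have "\<dots> = (\<Sum>i\<in>I. \<Sum>j\<in>I. c i * c j * ip d (p i) (p j))"
      unfolding v_def ip_sum_left sum_distrib_left
      by (intro sum.cong refl) (simp add: ip_commute)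
    finally show ?thesis
      by (simp add: nrm_square v_def)
  qed
  finally show ?thesis
    by (simp add: mult_left_mono)
qed

text \<open>The axis is the direction of the point of minimal norm in the convex hull of the vectors.\<close>

lemma acute_family_axis:
  fixes p :: "'i \<Rightarrow> point"
  assumes "finite I" "I \<noteq> {}" "d \<ge> 1"
    and unit: "\<And>i. i \<in> I \<Longrightarrow> nrm d (p i) = 1"
    and acute: "\<And>i j. \<lbrakk>i \<in> I; j \<in> I\<rbrakk> \<Longrightarrow> 0 \<le> ip d (p i) (p j)"
  obtains \<xi> where "nrm d \<xi> = 1" "\<And>i. i \<in> I \<Longrightarrow> 1 / sqrt d \<le> ip d \<xi> (p i)"
proof -
  \<comment> \<open>The probability simplex on I, with coefficients outside I pinned to 0.\<close>
  define S :: "('i \<Rightarrow> real) set" where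
    "S = {c. \<forall>i. 0 \<le> c i \<and> c i \<le> (if i \<in> I then 1 else 0)} \<inter> {c. sum c I = 1}"
  define comb where "comb c = (\<lambda>k. \<Sum>i\<in>I. c i * p i k)" for c
  have coord: "continuous_on UNIV (\<lambda>c::'i \<Rightarrow> real. c i)" for i
    by (rule continuous_on_product_coordinates)
  have "closed {c::'i \<Rightarrow> real. sum c I = 1}"
    by (intro closed_Collect_eq continuous_intros coord)
  then have "compact S"
    unfolding S_def using compact_box[of "\<lambda>_. 0"] by (rule compact_Int_closed[rotated])
  moreover obtain i0 where "i0 \<in> I"
    using assms(2) by blast
  then have "(\<lambda>i. if i = i0 then 1 else 0) \<in> S"
    using assms(1) by (auto simp: S_def)
  then have "S \<noteq> {}"
    by blast
  moreover have "continuous_on S (\<lambda>c. nrm d (comb c))"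
    unfolding comb_def by (intro continuous_intros continuous_on_subset[OF coord]) auto
  ultimately obtain c where c: "c \<in> S" and min: "\<And>c'. c' \<in> S \<Longrightarrow> nrm d (comb c) \<le> nrm d (comb c')"
    using continuous_attains_inf[of S "\<lambda>c. nrm d (comb c)"] by metis
  define v where "v = comb c"
  have v_ge: "1 \<le> real d * (nrm d v)\<^sup>2"
    unfolding v_def comb_def using c assms
    by (intro acute_combination_norm_ge) (auto simp: S_def)
  then have v_pos: "nrm d v > 0"
    using nrm_nonneg[of d v] by (cases "nrm d v = 0") (simp, linarith)
  have "1 / sqrt d \<le> ip d (\<lambda>k. inverse (nrm d v) * v k) (p j)" if j: "j \<in> I" for j
  proof -
    have "0 \<le> ip d v (\<lambda>k. p j k - v k)"
    proof (rule ip_nonneg_if_norm_minimal)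
      fix t :: real assume t: "0 < t" "t \<le> 1"
      \<comment> \<open>Moves the minimiser a fraction t towards the vertex j.\<close>
      define c' where "c' i = (1 - t) * c i + (if i = j then t else 0)" for i
      have sum1: "sum c' I = 1"
        using c j assms(1) by (simp add: c'_def S_def sum.distrib flip: sum_distrib_left)
      have nn: "0 \<le> c' i" for i
        using c t by (auto simp: c'_def S_def)
      have "c' i \<le> (if i \<in> I then 1 else 0)" for i
      proof (cases "i \<in> I")
        case True
        then show ?thesis
          using member_le_sum[of i I c'] nn assms(1) sum1 by simp
      next
        case False
        then have "c i = 0"
          using c by (auto simp: S_def intro: antisym dest: spec[of _ i])
        then show ?thesis
          using False j by (auto simp: c'_def)
      qed
      then have "c' \<in> S"
        using nn sum1 by (simp add: S_def)
      moreover have "comb c' = (\<lambda>k. v k + t * (p j k - v k))"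
      proof
        fix k
        have "comb c' k = (\<Sum>i\<in>I. (1 - t) * (c i * p i k) + (if i = j then t * p i k else 0))"
          unfolding comb_def c'_def by (intro sum.cong) (auto simp: algebra_simps)
        also have "\<dots> = (1 - t) * v k + t * p j k"
          using assms(1) j by (simp add: sum.distrib v_def comb_def flip: sum_distrib_left)
        finally show "comb c' k = v k + t * (p j k - v k)"
          by (simp add: algebra_simps)
      qed
      ultimately show "nrm d v \<le> nrm d (\<lambda>k. v k + t * (p j k - v k))"
        using min[of c'] by (simp add: v_def)
    qed
    \<comment> \<open>After normalising v, the inner product with \<open>p j\<close> is at least
      |v|, which \<open>v_ge\<close> bounds below by 1 / sqrt d.\<close>
    then have "(nrm d v)\<^sup>2 \<le> ip d v (p j)"
      by (simp add: ip_linear nrm_square)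
    then have "nrm d v \<le> ip d v (p j) / nrm d v"
      using v_pos by (simp add: field_simps power2_eq_square)
    moreover have "1 / sqrt d \<le> nrm d v"
    proof -
      have "1 \<le> sqrt (real d * (nrm d v)\<^sup>2)"
        using v_ge by simp
      then show ?thesis
        using assms(3) by (simp add: real_sqrt_mult field_simps)
    qed
    ultimately show ?thesis
      by (simp add: ip_scale_left divide_inverse mult.commute[of "ip d v (p j)"])
  qed
  moreover have "nrm d (\<lambda>k. inverse (nrm d v) * v k) = 1"
    using v_pos by (simp only: nrm_scale) simp
  ultimately show ?thesis
    using that by blast
qed

text \<open>Reduces to unit vectors: those of norm zero satisfy the bound trivially, and
  \<open>p0\<close> keeps the normalised family nonempty.\<close>

lemma acute_set_axis:
  assumes "finite P" "d \<ge> 1" "p0 \<in> P" "nrm d p0 \<noteq> 0"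
    and acute: "\<And>p q. \<lbrakk>p \<in> P; q \<in> P\<rbrakk> \<Longrightarrow> 0 \<le> ip d p q"
  obtains \<xi> where "nrm d \<xi> = 1" "\<And>p. p \<in> P \<Longrightarrow> nrm d p / sqrt d \<le> ip d \<xi> p"
proof -
  define I where "I = {p \<in> P. nrm d p \<noteq> 0}"
  have unit: "nrm d (\<lambda>k. inverse (nrm d p) * p k) = 1" if "p \<in> I" for p
    using that by (simp only: nrm_scale) (simp add: I_def)
  obtain \<xi> where \<xi>: "nrm d \<xi> = 1"
    "\<And>p. p \<in> I \<Longrightarrow> 1 / sqrt d \<le> ip d \<xi> (\<lambda>k. inverse (nrm d p) * p k)"
  proof (rule acute_family_axis[of I d "\<lambda>p k. inverse (nrm d p) * p k"])
    show "0 \<le> ip d (\<lambda>k. inverse (nrm d p) * p k) (\<lambda>k. inverse (nrm d q) * q k)"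
      if "p \<in> I" "q \<in> I" for p q
      using that acute[of p q] by (simp add: ip_linear I_def)
  qed (use assms unit in \<open>auto simp: I_def\<close>)
  have "nrm d p / sqrt d \<le> ip d \<xi> p" if "p \<in> P" for p
  proof (cases "nrm d p = 0")
    case True
    then show ?thesis
      using abs_ip_le[of d \<xi> p] by simp
  next
    case False
    then have "nrm d p > 0"
      using nrm_nonneg[of d p] by linarith
    moreover have "1 / sqrt d \<le> inverse (nrm d p) * ip d \<xi> p"
      using \<xi>(2)[of p] that False by (simp only: ip_scale_right) (simp add: I_def)
    ultimately show ?thesis
      by (simp add: field_simps)
  qed
  then show ?thesis
    using that \<xi>(1) by blast
qed

section \<open>Lebesgue measure on coordinate sequences\<close>

text \<open>Points of this product space are \<open>undefined\<close>, not 0, from coordinate d on.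
  Maps into it are therefore restricted, which \<open>ip\<close> and \<open>nrm\<close> do not
  see.\<close>

definition leb :: "nat \<Rightarrow> point measure" where
  "leb d = PiM {..<d} (\<lambda>_. lborel)"

definition origin_ball :: "nat \<Rightarrow> real \<Rightarrow> point set" where
  "origin_ball d r = {z \<in> space (leb d). nrm d z \<le> r}"

lemma ip_restrict [simp]:
  "ip d (restrict x {..<d}) y = ip d x y" "ip d y (restrict x {..<d}) = ip d y x"
  by (simp_all add: ip_def)

lemma nrm_restrict [simp]: "nrm d (restrict x {..<d}) = nrm d x"
  by (simp add: nrm_eq_sqrt)

lemma measurable_ip [measurable]: "(\<lambda>z. ip d z y) \<in> borel_measurable (leb d)"
  unfolding ip_def leb_def by measurable

lemma measurable_nrm [measurable]: "(\<lambda>z. nrm d z) \<in> borel_measurable (leb d)"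
  unfolding nrm_eq_sqrt ip_def leb_def by measurable

lemma origin_ball_sets [measurable]: "origin_ball d r \<in> sets (leb d)"
  unfolding origin_ball_def by measurable

section \<open>Invariance of Lebesgue measure under translations and reflections\<close>

lemma emeasure_lborel_affine_vimage:
  assumes "A \<in> sets borel" "\<bar>s\<bar> = (1::real)"
  shows "emeasure lborel ((\<lambda>x. t + s * x) -` A) = emeasure lborel A"
proof -
  have "distr lborel borel (\<lambda>x. t + s * x) = (lborel :: real measure)"
    using lborel_real_affine[of s t] assms(2) by (auto simp: density_1)
  then have "emeasure lborel A = emeasure (distr lborel borel (\<lambda>x. t + s * x)) A"
    by simp
  then show ?thesis
    using assms(1) by (simp add: emeasure_distr)
qed

lemma measurable_affine:
  "(\<lambda>z. \<lambda>i\<in>{..<d}. t i + s * z i) \<in> measurable (leb d) (leb d)"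
  unfolding leb_def by (rule measurable_restrict) measurable

text \<open>Boxes determine the product measure, so invariance can be checked coordinate by
  coordinate. Translations (s = 1) will move balls; the reflection (s = -1) gives the symmetry of
  the lens.\<close>

lemma distr_leb_affine:
  assumes "\<bar>s\<bar> = (1::real)"
  shows "distr (leb d) (leb d) (\<lambda>z. \<lambda>i\<in>{..<d}. t i + s * z i) = leb d"
proof -
  interpret product_sigma_finite "\<lambda>_::nat. lborel :: real measure"
    by standard
  let ?f = "\<lambda>z. \<lambda>i\<in>{..<d}. t i + s * z i"
  have "distr (leb d) (leb d) ?f = PiM {..<d} (\<lambda>_. lborel)"
  proof (rule PiM_eqI)
    fix A :: "nat \<Rightarrow> real set"
    assume A: "\<And>i. i \<in> {..<d} \<Longrightarrow> A i \<in> sets lborel"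
    have "?f -` (PiE {..<d} A) \<inter> space (leb d) = PiE {..<d} (\<lambda>i. (\<lambda>x. t i + s * x) -` A i)"
      by (auto simp: leb_def space_PiM PiE_iff)
    moreover have "PiE {..<d} A \<in> sets (leb d)"
      unfolding leb_def using A by (intro sets_PiM_I_finite) auto
    ultimately have "emeasure (distr (leb d) (leb d) ?f) (PiE {..<d} A)
        = emeasure (leb d) (PiE {..<d} (\<lambda>i. (\<lambda>x. t i + s * x) -` A i))"
      by (simp add: emeasure_distr[OF measurable_affine])
    also have "\<dots> = (\<Prod>i<d. emeasure lborel ((\<lambda>x. t i + s * x) -` A i))"
      unfolding leb_def
    proof (rule emeasure_PiM)
      fix i assume i: "i \<in> {..<d}"
      have "(\<lambda>x. t i + s * x) -` A i \<inter> space borel \<in> sets borel"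
        using A[OF i] by (intro measurable_sets[where A = borel]) auto
      then show "(\<lambda>x. t i + s * x) -` A i \<in> sets lborel"
        by simp
    qed simp
    also have "\<dots> = (\<Prod>i<d. emeasure lborel (A i))"
      using A assms by (intro prod.cong) (auto simp: emeasure_lborel_affine_vimage)
    finally show "emeasure (distr (leb d) (leb d) ?f) (PiE {..<d} A) = (\<Prod>i\<in>{..<d}. emeasure lborel (A i))" .
  qed (auto simp: leb_def)
  then show ?thesis
    by (simp add: leb_def)
qed

lemma integral_leb_affine:
  fixes f :: "point \<Rightarrow> real"
  assumes "\<bar>s\<bar> = (1::real)" and [measurable]: "f \<in> borel_measurable (leb d)"
  shows "(\<integral>z. f (\<lambda>i\<in>{..<d}. t i + s * z i) \<partial>leb d) = (\<integral>z. f z \<partial>leb d)"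
  using integral_distr[OF measurable_affine assms(2), of t s] distr_leb_affine[OF assms(1), of d t]
  by simp

lemma integrable_leb_affine:
  fixes f :: "point \<Rightarrow> real"
  assumes "\<bar>s\<bar> = (1::real)" "integrable (leb d) f"
  shows "integrable (leb d) (\<lambda>z. f (\<lambda>i\<in>{..<d}. t i + s * z i))"
  using integrable_distr[OF measurable_affine, of d t s f] distr_leb_affine[OF assms(1), of d t] assms(2)
  by simp

section \<open>Volumes of balls, caps and the lens\<close>

lemma emeasure_origin_ball:
  assumes "r > 0"
  shows "emeasure (leb d) (origin_ball d r) = ennreal (unit_ball_vol d * r ^ d)"
  using emeasure_cball_aux[of "{..<d}" r] assms
  by (simp add: origin_ball_def leb_def nrm_def L2_set_def Int_def conj_commute)

lemma measure_origin_ball: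
  assumes "r > 0"
  shows "measure (leb d) (origin_ball d r) = unit_ball_vol d * r ^ d"
  using assms by (simp add: measure_def emeasure_origin_ball)

lemma emeasure_translated_origin_ball:
  "emeasure (leb d) {z \<in> space (leb d). nrm d (\<lambda>i. z i - c i) \<le> r} = emeasure (leb d) (origin_ball d r)"
proof -
  let ?f = "\<lambda>z. \<lambda>i\<in>{..<d}. - c i + 1 * z i"
  have "emeasure (leb d) (origin_ball d r) = emeasure (distr (leb d) (leb d) ?f) (origin_ball d r)"
    by (subst distr_leb_affine) auto
  also have "\<dots> = emeasure (leb d) (?f -` origin_ball d r \<inter> space (leb d))"
    by (rule emeasure_distr[OF measurable_affine origin_ball_sets])
  also have "?f -` origin_ball d r \<inter> space (leb d) = {z \<in> space (leb d). nrm d (\<lambda>i. z i - c i) \<le> r}"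
    using measurable_space[OF measurable_affine, of _ d "\<lambda>i. - c i" 1] by (auto simp: origin_ball_def)
  finally show ?thesis ..
qed

text \<open>A spherical cap cut off at height \<open>2 / d\<close> lies in a ball of squared radius \<open>1 / d - 4 / d\<^sup>2\<close>.\<close>

lemma cap_measure_le:
  assumes "d \<ge> 1" "nrm d \<xi> = 1"
  shows "measure (leb d) {z \<in> origin_ball d (1 / sqrt d). ip d z \<xi> > 2 / d}
      \<le> measure (leb d) (origin_ball d (1 / sqrt d)) / 4"
proof (cases "d \<le> 4")
  case True
  \<comment> \<open>For d <= 4 the cutting height 2 / d is at least the radius 1 / sqrt d, so the
    cap is empty.\<close>
  have "ip d z \<xi> \<le> 2 / d" if "nrm d z \<le> 1 / sqrt d" for z
  proof -
    have "sqrt d \<le> sqrt 4"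
      using True by (intro real_sqrt_le_mono) simp
    then have "sqrt d * sqrt d \<le> 2 * sqrt d"
      by (intro mult_right_mono) auto
    then have "1 / sqrt d \<le> 2 / d"
      using assms(1) by (simp add: field_simps)
    moreover have "ip d z \<xi> \<le> nrm d z"
      using abs_ip_le[of d z \<xi>] assms(2) by simp
    ultimately show ?thesis
      using that by simp
  qed
  then have "{z \<in> origin_ball d (1 / sqrt d). ip d z \<xi> > 2 / d} = {}"
    by (auto simp: origin_ball_def not_less)
  then show ?thesis
    by (simp only: measure_empty) simp
next
  case False
  define q where "q = sqrt (1 - 4 / d)"
  have q: "q > 0"
    using False by (simp add: q_def)
  \<comment> \<open>The covering ball is centred at (2 / d) \<xi>; expanding the square gives 1 / d
    - 8 / d^2 + 4 / d^2 = q^2 / d.\<close>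
  have "{z \<in> origin_ball d (1 / sqrt d). ip d z \<xi> > 2 / d}
      \<subseteq> {z \<in> space (leb d). nrm d (\<lambda>i. z i - 2 / d * \<xi> i) \<le> 1 / sqrt d * q}"
  proof (intro subsetI CollectI conjI)
    fix z assume z: "z \<in> {z \<in> origin_ball d (1 / sqrt d). ip d z \<xi> > 2 / d}"
    have "(nrm d z)\<^sup>2 \<le> (1 / sqrt d)\<^sup>2"
      using z by (intro power_mono) (auto simp: origin_ball_def)
    then have zz: "ip d z z \<le> 1 / d"
      by (simp add: nrm_square power_divide)
    have "ip d \<xi> \<xi> = 1"
      using assms(2) by (simp flip: nrm_square)
    then have "(nrm d (\<lambda>i. z i - 2 / d * \<xi> i))\<^sup>2 = ip d z z - 4 / d * ip d z \<xi> + (2 / d)\<^sup>2"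
      unfolding nrm_square ip_linear ip_commute[of d \<xi> z] by (simp add: power2_eq_square)
    also have "\<dots> \<le> 1 / d - 4 / d * (2 / d) + (2 / d)\<^sup>2"
      using z zz by (intro add_mono diff_mono mult_left_mono) auto
    also have "\<dots> = (1 / sqrt d * q)\<^sup>2"
      using False by (simp add: q_def power_mult_distrib power_divide) (simp add: field_simps power2_eq_square)
    finally show "nrm d (\<lambda>i. z i - 2 / d * \<xi> i) \<le> 1 / sqrt d * q"
      by (rule power2_le_imp_le) (use q in simp)
  qed (auto simp: origin_ball_def)
  then have "emeasure (leb d) {z \<in> origin_ball d (1 / sqrt d). ip d z \<xi> > 2 / d}
      \<le> emeasure (leb d) {z \<in> space (leb d). nrm d (\<lambda>i. z i - 2 / d * \<xi> i) \<le> 1 / sqrt d * q}"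
    by (rule emeasure_mono) (unfold nrm_eq_sqrt ip_def leb_def, measurable)
  also have "\<dots> = ennreal (unit_ball_vol d * (1 / sqrt d * q) ^ d)"
    using q False by (simp only: emeasure_translated_origin_ball) (subst emeasure_origin_ball, auto)
  finally have "measure (leb d) {z \<in> origin_ball d (1 / sqrt d). ip d z \<xi> > 2 / d}
      \<le> unit_ball_vol d * (1 / sqrt d * q) ^ d"
    using q by (simp add: measure_def enn2real_leI)
  also have "\<dots> = unit_ball_vol d * (1 / sqrt d) ^ d * q ^ d"
    by (simp only: power_mult_distrib mult.assoc)
  also have "\<dots> \<le> unit_ball_vol d * (1 / sqrt d) ^ d * (1 / 4)"
  proof (rule mult_left_mono)
    \<comment> \<open>The volume ratio is q^d = (1 - 4 / d)^(d / 2) <= exp (-2) <= 1 / 4.\<close>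
    have "1 - 4 / d \<le> exp (- 4 / d)"
      using exp_ge_add_one_self[of "- 4 / d"] by simp
    also have "\<dots> = (exp (- 2 / d))\<^sup>2"
      by (simp flip: exp_double)
    finally have "q \<le> exp (- 2 / d)"
      unfolding q_def by (rule real_le_lsqrt[rotated]) simp
    then have "q ^ d \<le> exp (- 2 / d) ^ d"
      using q by (intro power_mono) auto
    also have "\<dots> = inverse (exp 1 ^ 2)"
      using False by (simp flip: exp_of_nat_mult exp_minus)
    also have "\<dots> \<le> inverse (2 ^ 2)"
      using exp_ge_add_one_self[of 1] by (intro le_imp_inverse_le power_mono) auto
    finally show "q ^ d \<le> 1 / 4"
      by simp
  qed simp
  also have "\<dots> = measure (leb d) (origin_ball d (1 / sqrt d)) / 4"
    using False by (subst measure_origin_ball) auto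
  finally show ?thesis .
qed

text \<open>The slab cuts off the caps around both ends of the axis. On it the cross term of |\<xi>
  + z|^2 is O(1 / d), where the full ball allows O(1 / sqrt d); this keeps the d-th power of the
  enclosing radius bounded.\<close>

definition lens :: "nat \<Rightarrow> point \<Rightarrow> point set" where
  "lens d \<xi> = {z \<in> origin_ball d (1 / sqrt d). \<bar>ip d z \<xi>\<bar> \<le> 2 / d}"

lemma lens_sets [measurable]: "lens d \<xi> \<in> sets (leb d)"
  unfolding lens_def origin_ball_def by measurable

lemma emeasure_origin_ball_finite: "emeasure (leb d) (origin_ball d r) < \<infinity>"
proof -
  have "emeasure (leb d) (origin_ball d r) \<le> emeasure (leb d) (origin_ball d (\<bar>r\<bar> + 1))"
    by (intro emeasure_mono) (auto simp: origin_ball_def)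
  also have "\<dots> < \<infinity>"
    by (simp add: emeasure_origin_ball)
  finally show ?thesis .
qed

text \<open>The slab removes two opposite caps, each of at most a quarter of the volume.\<close>

lemma lens_measure_ge:
  assumes "d \<ge> 1" "nrm d \<xi> = 1"
  shows "measure (leb d) (origin_ball d (1 / sqrt d)) / 2 \<le> measure (leb d) (lens d \<xi>)"
proof -
  let ?B = "origin_ball d (1 / sqrt d)"
  let ?C1 = "{z \<in> ?B. ip d z \<xi> > 2 / d}" and ?C2 = "{z \<in> ?B. ip d z (\<lambda>i. - \<xi> i) > 2 / d}"
  have neg: "ip d z (\<lambda>i. - \<xi> i) = - ip d z \<xi>" for z
    by (simp add: ip_def sum_negf)
  have fm: "A \<in> fmeasurable (leb d)" if "A \<in> sets (leb d)" "A \<subseteq> ?B" for A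
    using that emeasure_origin_ball_finite[of d "1 / sqrt d"] emeasure_mono[OF that(2) origin_ball_sets]
    by (intro fmeasurableI) (auto intro: le_less_trans)
  have C [measurable]: "?C1 \<in> sets (leb d)" "?C2 \<in> sets (leb d)"
    unfolding origin_ball_def by measurable
  have "measure (leb d) ?B \<le> measure (leb d) (lens d \<xi> \<union> (?C1 \<union> ?C2))"
    by (intro measure_mono_fmeasurable fm) (auto simp: lens_def neg)
  also have "\<dots> \<le> measure (leb d) (lens d \<xi>) + measure (leb d) (?C1 \<union> ?C2)"
    by (intro measure_Un_le) auto
  also have "measure (leb d) (?C1 \<union> ?C2) \<le> measure (leb d) ?C1 + measure (leb d) ?C2"
    by (intro measure_Un_le) auto
  also have "measure (leb d) ?C1 \<le> measure (leb d) ?B / 4"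
    using assms by (rule cap_measure_le)
  also have "measure (leb d) ?C2 \<le> measure (leb d) ?B / 4"
    using assms by (intro cap_measure_le) (auto simp: nrm_def L2_set_def)
  finally show ?thesis
    by simp
qed

lemma integrable_bounded_on_origin_ball:
  fixes f :: "point \<Rightarrow> real"
  assumes [measurable]: "f \<in> borel_measurable (leb d)" and "A \<in> sets (leb d)" "A \<subseteq> origin_ball d r"
    and bound: "\<And>z. z \<in> A \<Longrightarrow> \<bar>f z\<bar> \<le> b"
  shows "integrable (leb d) (\<lambda>z. indicator A z * f z)"
proof (rule Bochner_Integration.integrable_bound)
  show "integrable (leb d) (\<lambda>z. indicator (origin_ball d r) z * b)"
    using emeasure_origin_ball_finite[of d r] by (intro integrable_mult_left integrable_real_indicator) auto
  show "AE z in leb d. norm (indicator A z * f z) \<le> norm (indicator (origin_ball d r) z * b)"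
  proof (intro AE_I2)
    fix z
    show "norm (indicator A z * f z) \<le> norm (indicator (origin_ball d r) z * b)"
      using bound[of z] assms(3) by (auto simp: indicator_def)
  qed
qed (use assms in measurable)

text \<open>The lens is symmetric about the origin, so the linear term integrates to zero.\<close>

lemma integral_lens_affine:
  shows "integrable (leb d) (\<lambda>z. indicator (lens d \<xi>) z * (a + ip d z w))"
    and "(\<integral>z. indicator (lens d \<xi>) z * (a + ip d z w) \<partial>leb d) = a * measure (leb d) (lens d \<xi>)"
proof -
  have sub: "lens d \<xi> \<subseteq> origin_ball d (1 / sqrt d)"
    by (auto simp: lens_def)
  have ipb: "\<bar>ip d z w\<bar> \<le> 1 / sqrt d * nrm d w" if "z \<in> lens d \<xi>" for z
    by (rule order_trans[OF abs_ip_le mult_right_mono]) (use that in \<open>auto simp: lens_def origin_ball_def\<close>)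
  show "integrable (leb d) (\<lambda>z. indicator (lens d \<xi>) z * (a + ip d z w))"
  proof (rule integrable_bounded_on_origin_ball[OF _ lens_sets sub])
    show "\<bar>a + ip d z w\<bar> \<le> \<bar>a\<bar> + 1 / sqrt d * nrm d w" if "z \<in> lens d \<xi>" for z
      using ipb[OF that] by linarith
  qed measurable
  have i1: "integrable (leb d) (\<lambda>z. indicator (lens d \<xi>) z * ip d z w)"
    by (rule integrable_bounded_on_origin_ball[OF _ lens_sets sub ipb]) measurable
  have i2: "integrable (leb d) (\<lambda>z. indicator (lens d \<xi>) z * a)"
    by (rule integrable_bounded_on_origin_ball[OF _ lens_sets sub, where b = "\<bar>a\<bar>"]) auto
  let ?I = "\<integral>z. indicator (lens d \<xi>) z * ip d z w \<partial>leb d"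
  have "?I = (\<integral>z. indicator (lens d \<xi>) (\<lambda>i\<in>{..<d}. 0 + (-1) * z i)
      * ip d (\<lambda>i\<in>{..<d}. 0 + (-1) * z i) w \<partial>leb d)"
    by (rule integral_leb_affine[symmetric]) auto
  also have "\<dots> = (\<integral>z. - (indicator (lens d \<xi>) z * ip d z w) \<partial>leb d)"
  proof (intro Bochner_Integration.integral_cong refl)
    fix z assume z: "z \<in> space (leb d)"
    have "(\<lambda>i\<in>{..<d}. - z i) \<in> space (leb d)"
      using measurable_space[OF measurable_affine z, of "\<lambda>_. 0" "-1"] by simp
    moreover have "nrm d (\<lambda>i. - z i) = nrm d z"
      by (simp add: nrm_def L2_set_def)
    ultimately have "(\<lambda>i\<in>{..<d}. - z i) \<in> lens d \<xi> \<longleftrightarrow> z \<in> lens d \<xi>"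
      using z by (simp add: lens_def origin_ball_def ip_minus_left)
    then show "indicator (lens d \<xi>) (\<lambda>i\<in>{..<d}. 0 + (-1) * z i)
      * ip d (\<lambda>i\<in>{..<d}. 0 + (-1) * z i) w = - (indicator (lens d \<xi>) z * ip d z w)"
      by (simp add: indicator_def ip_minus_left)
  qed
  also have "\<dots> = - ?I"
    by simp
  finally have "?I = 0"
    by simp
  then have "(\<integral>z. indicator (lens d \<xi>) z * a + indicator (lens d \<xi>) z * ip d z w \<partial>leb d)
      = a * measure (leb d) (lens d \<xi>)"
    using i1 i2 sets.sets_into_space[OF lens_sets, of d \<xi>]
    by (simp add: Int_absorb2 mult.commute)
  then show "(\<integral>z. indicator (lens d \<xi>) z * (a + ip d z w) \<partial>leb d) = a * measure (leb d) (lens d \<xi>)"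
    by (simp add: distrib_left)
qed

section \<open>The length of a greedy walk\<close>

lemma norm_axis_plus_lens_le:
  assumes "d \<ge> 1" "nrm d \<xi> = 1" "z \<in> lens d \<xi>"
  shows "nrm d (\<lambda>i. \<xi> i + z i) \<le> sqrt (1 + 5 / d)"
proof -
  have "(nrm d z)\<^sup>2 \<le> (1 / sqrt d)\<^sup>2"
    using assms(3) by (intro power_mono) (auto simp: lens_def origin_ball_def)
  then have "ip d z z \<le> 1 / d"
    by (simp add: nrm_square power_divide)
  moreover have "ip d \<xi> \<xi> = 1"
    using assms(2) by (simp flip: nrm_square)
  moreover have "ip d z \<xi> \<le> 2 / d"
    using assms(3) by (simp add: lens_def abs_le_iff)
  \<comment> \<open>The 5 is 4 from the cross term plus 1 from |z|^2.\<close>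
  moreover have "2 * (2 / real d) + 1 / d = 5 / d"
    by (simp add: field_simps)
  ultimately have "ip d \<xi> \<xi> + 2 * ip d z \<xi> + ip d z z \<le> 1 + 5 / d"
    by linarith
  then show ?thesis
    unfolding nrm_eq_sqrt by (simp add: ip_linear ip_commute[of d \<xi> z] algebra_simps)
qed

text \<open>\<open>obtuse\<close> is the variational inequality of a projection onto a convex set
  containing all later points; it is all that the length bound takes from the greedy rule.\<close>

locale greedy_walk =
  fixes d :: nat and x :: "nat \<Rightarrow> point" and N :: nat
  assumes d_pos: "d \<ge> 1"
    and obtuse: "\<And>t u. \<lbrakk>t < u; u \<le> N\<rbrakk>
      \<Longrightarrow> ip d (\<lambda>i. x t i - x (Suc t) i) (\<lambda>i. x u i - x (Suc t) i) \<le> 0"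
begin

text \<open>In the triangle x_t, x_(t+1), x_u the angle at x_(t+1) is not acute, so the opposite
  side is the longest. Such walks are known as self-contracted.\<close>

lemma edist_antimono:
  assumes "s \<le> t" "t \<le> u" "u \<le> N"
  shows "edist d (x t) (x u) \<le> edist d (x s) (x u)"
  using assms(1,2)
proof (induction rule: dec_induct)
  case (step t)
  have "(edist d (x (Suc t)) (x u))\<^sup>2 \<le> (edist d (x t) (x u))\<^sup>2"
    using obtuse[of t u] step.prems assms(3) ip_nonneg[of d "\<lambda>i. x t i - x (Suc t) i"]
    by (simp add: edist_square ip_linear ip_commute[of d "x (Suc t)" "x t"]
        ip_commute[of d "x (Suc t)" "x u"])
  then have "edist d (x (Suc t)) (x u) \<le> edist d (x t) (x u)"
    by (rule power2_le_imp_le) (simp add: edist_eq_nrm)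
  then show ?case
    using step by simp
qed simp

text \<open>Twice the inner product is |x_u - x_k|^2 + |x_v - x_k|^2 - |x_u - x_v|^2; for u <= v the
  last square is at most the middle one by \<open>edist_antimono\<close>.\<close>

lemma acute_future:
  assumes "k \<le> u" "k \<le> v" "u \<le> N" "v \<le> N"
  shows "0 \<le> ip d (\<lambda>i. x u i - x k i) (\<lambda>i. x v i - x k i)"
  using assms
proof (induction u v rule: linorder_wlog)
  case (le u v)
  have "(edist d (x u) (x v))\<^sup>2 \<le> (edist d (x k) (x v))\<^sup>2"
    using edist_antimono[of k u v] le by (intro power_mono) (auto simp: edist_eq_nrm)
  then show ?case
    using ip_nonneg[of d "\<lambda>i. x u i - x k i"]
    by (simp add: edist_square ip_linear ip_commute[of d "x u" "x k"])
next
  case (sym u v)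
  then show ?case
    by (simp add: ip_commute)
qed

text \<open>
  Minus the support function, at \<open>- \<eta>\<close>, of the convex hull of the points that remain at time \<open>k\<close>.
\<close>

definition low :: "nat \<Rightarrow> point \<Rightarrow> real" where
  "low k \<eta> = Min ((\<lambda>u. ip d \<eta> (x u)) ` {k..N})"

lemma low_le: "\<lbrakk>k \<le> u; u \<le> N\<rbrakk> \<Longrightarrow> low k \<eta> \<le> ip d \<eta> (x u)"
  unfolding low_def by (intro Min_le) auto

lemma low_mono: "\<lbrakk>k \<le> l; l \<le> N\<rbrakk> \<Longrightarrow> low k \<eta> \<le> low l \<eta>"
  unfolding low_def by (intro Min_antimono) auto

lemma low_restrict [simp]: "low k (restrict \<eta> {..<d}) = low k \<eta>"
  by (simp add: low_def)

lemma measurable_low [measurable]: "low k \<in> borel_measurable (leb d)"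
  unfolding low_def by (intro borel_measurable_Min) auto

text \<open>If \<open>low k\<close> is attained at x_u, then comparison with x_N bounds the
  difference by <\<eta>, x_N - x_u>, and x_u is no farther from x_N than x_0 is.\<close>

lemma low_diff_le:
  assumes "k \<le> l" "l \<le> N"
  shows "low l \<eta> - low k \<eta> \<le> nrm d \<eta> * edist d (x 0) (x N)"
proof -
  have "low k \<eta> \<in> (\<lambda>u. ip d \<eta> (x u)) ` {k..N}"
    unfolding low_def using assms by (intro Min_in) auto
  then obtain u where u: "u \<le> N" "low k \<eta> = ip d \<eta> (x u)"
    by auto
  have "low l \<eta> - low k \<eta> \<le> ip d \<eta> (\<lambda>i. x N i - x u i)"
    using low_le[of l N \<eta>] assms u by (simp add: ip_linear)
  also have "\<dots> \<le> nrm d \<eta> * edist d (x N) (x u)"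
    using abs_ip_le[of d \<eta> "\<lambda>i. x N i - x u i"] by (simp add: edist_eq_nrm)
  also have "edist d (x N) (x u) \<le> edist d (x 0) (x N)"
    using edist_antimono[of 0 u N] u by (simp add: edist_commute)
  finally show ?thesis
    by (simp add: mult_left_mono)
qed

abbreviation R :: real where "R \<equiv> sqrt (1 + 5 / d)"

lemma integrable_low_diff:
  assumes "k \<le> l" "l \<le> N"
  shows "integrable (leb d) (\<lambda>\<eta>. indicator (origin_ball d R) \<eta> * (low l \<eta> - low k \<eta>))"
proof (rule integrable_bounded_on_origin_ball[OF _ origin_ball_sets order_refl])
  fix \<eta> assume "\<eta> \<in> origin_ball d R"
  then have "nrm d \<eta> * edist d (x 0) (x N) \<le> R * edist d (x 0) (x N)"
    by (intro mult_right_mono) (auto simp: origin_ball_def edist_eq_nrm)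
  then show "\<bar>low l \<eta> - low k \<eta>\<bar> \<le> R * edist d (x 0) (x N)"
    using low_diff_le[OF assms, of \<eta>] low_mono[OF assms, of \<eta>] by simp
qed measurable

text \<open>On the lens translated by \<xi> the integrand is at least <\<xi> + z, T>, where T is the
  step; elsewhere it is nonnegative. By symmetry of the lens, the average there is <\<xi>, T> >= |T|
  / sqrt d.\<close>

lemma step_bound:
  assumes k: "k < N"
  shows "edist d (x (Suc k)) (x k) / sqrt d * (measure (leb d) (origin_ball d (1 / sqrt d)) / 2)
    \<le> (\<integral>\<eta>. indicator (origin_ball d R) \<eta> * (low (Suc k) \<eta> - low k \<eta>) \<partial>leb d)"
proof (cases "edist d (x (Suc k)) (x k) = 0")
  \<comment> \<open>A vanishing step is treated apart, since the axis lemma asks for a vector of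
    nonzero norm.\<close>
  case True
  then show ?thesis
    using low_mono[of k "Suc k"] k by (auto intro!: integral_nonneg)
next
  case False
  define T where "T = (\<lambda>i. x (Suc k) i - x k i)"
  define P where "P = insert T ((\<lambda>u i. x u i - x (Suc k) i) ` {Suc k..N})"
  have T_future: "0 \<le> ip d T (\<lambda>i. x u i - x (Suc k) i)" if "Suc k \<le> u" "u \<le> N" for u
    using obtuse[of k u] that by (simp add: T_def ip_linear)
  obtain \<xi> where \<xi>: "nrm d \<xi> = 1" and axis: "\<And>p. p \<in> P \<Longrightarrow> nrm d p / sqrt d \<le> ip d \<xi> p"
  proof (rule acute_set_axis[of P d T])
    show "0 \<le> ip d p q" if "p \<in> P" "q \<in> P" for p q
      using that T_future T_future[unfolded ip_commute[of d T]] acute_future[of "Suc k"]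
        ip_nonneg[of d T]
      by (auto simp: P_def)
    show "nrm d T \<noteq> 0"
      using False by (simp add: T_def edist_eq_nrm)
  qed (use d_pos in \<open>auto simp: P_def\<close>)
  \<comment> \<open>Perturbing \<xi> by z costs at most |p| / sqrt d, exactly what the axis
    guarantees.\<close>
  have cone: "0 \<le> ip d (\<lambda>i. \<xi> i + z i) p" if "z \<in> lens d \<xi>" "p \<in> P" for z p
  proof -
    have "\<bar>ip d z p\<bar> \<le> 1 / sqrt d * nrm d p"
      by (rule order_trans[OF abs_ip_le mult_right_mono])
        (use that in \<open>auto simp: lens_def origin_ball_def\<close>)
    then show ?thesis
      using axis[OF that(2)] by (simp add: ip_linear)
  qed
  let ?s = "\<lambda>z. \<lambda>i\<in>{..<d}. \<xi> i + 1 * z i"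
  let ?F = "\<lambda>\<eta>. indicator (origin_ball d R) \<eta> * (low (Suc k) \<eta> - low k \<eta>)"
  have F_nonneg: "0 \<le> ?F \<eta>" for \<eta>
    using low_mono[of k "Suc k" \<eta>] k by simp
  have "edist d (x (Suc k)) (x k) / sqrt d * (measure (leb d) (origin_ball d (1 / sqrt d)) / 2)
      \<le> ip d \<xi> T * measure (leb d) (lens d \<xi>)"
    using axis[of T] lens_measure_ge[OF d_pos \<xi>]
    by (intro mult_mono) (auto simp: P_def T_def edist_eq_nrm intro: order_trans[rotated])
  also have "\<dots> = (\<integral>z. indicator (lens d \<xi>) z * (ip d \<xi> T + ip d z T) \<partial>leb d)"
    by (rule integral_lens_affine(2)[symmetric])
  also have "\<dots> \<le> (\<integral>z. ?F (?s z) \<partial>leb d)"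
  proof (rule integral_mono[OF integral_lens_affine(1) integrable_leb_affine])
    show "integrable (leb d) ?F"
      using k by (intro integrable_low_diff) auto
    fix z assume z: "z \<in> space (leb d)"
    show "indicator (lens d \<xi>) z * (ip d \<xi> T + ip d z T) \<le> ?F (?s z)"
    proof (cases "z \<in> lens d \<xi>")
      case True
      let ?\<eta> = "\<lambda>i. \<xi> i + z i"
      \<comment> \<open>On the dual cone the minimum over the remaining points sits at
        x_(k+1).\<close>
      have "ip d ?\<eta> (x (Suc k)) \<le> low (Suc k) ?\<eta>"
        unfolding low_def
      proof (rule Min.boundedI)
        fix a assume "a \<in> (\<lambda>u. ip d ?\<eta> (x u)) ` {Suc k..N}"
        then obtain u where u: "u \<in> {Suc k..N}" "a = ip d ?\<eta> (x u)"
          by blast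
        then show "ip d ?\<eta> (x (Suc k)) \<le> a"
          using cone[OF True, of "\<lambda>i. x u i - x (Suc k) i"] by (simp add: P_def ip_diff_right)
      qed (use k in auto)
      moreover have "low k ?\<eta> \<le> ip d ?\<eta> (x k)"
        using k by (intro low_le) auto
      moreover have "?s z \<in> origin_ball d R"
        using measurable_space[OF measurable_affine z, of \<xi> 1] norm_axis_plus_lens_le[OF d_pos \<xi> True]
        by (simp add: origin_ball_def)
      ultimately show ?thesis
        using True by (simp add: T_def ip_linear)
    next
      case False
      then show ?thesis
        using F_nonneg[of "?s z"] by simp
    qed
  qed simp
  also have "\<dots> = (\<integral>\<eta>. ?F \<eta> \<partial>leb d)"
    by (rule integral_leb_affine) auto
  finally show ?thesis .
qed

text \<open>The squared radius is at most exp (5 / d), and (d + 1) / (2 d) <= 1. Of the exponent, d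
  belongs to the volume of the ball and 1 to the norm factor in \<open>low_diff_le\<close>.\<close>

lemma R_power_le: "R ^ Suc d \<le> exp 5"
proof -
  have "1 + 5 / d \<le> exp (5 / d)"
    using exp_ge_add_one_self by blast
  also have "\<dots> = (exp (5 / (2 * d)))\<^sup>2"
    by (simp flip: exp_double)
  finally have "R \<le> exp (5 / (2 * d))"
    by (intro real_le_lsqrt) auto
  then have "R ^ Suc d \<le> exp (5 / (2 * d)) ^ Suc d"
    by (intro power_mono) auto
  also have "\<dots> = exp (Suc d * (5 / (2 * d)))"
    by (rule exp_of_nat_mult[symmetric])
  also have "\<dots> \<le> exp 5"
    using d_pos by (simp add: field_simps)
  finally show ?thesis .
qed

text \<open>Of the factors in \<open>sqrt d ^ Suc d\<close>, one is the alignment loss between axis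
  and step, and d come from the volume of the ball of radius 1 / sqrt d.\<close>

theorem length_le:
  "(\<Sum>t<N. edist d (x (Suc t)) (x t))
    \<le> 2 * exp 5 * real d powr ((real d + 1) / 2) * edist d (x 0) (x N)"
proof -
  let ?L = "\<Sum>t<N. edist d (x (Suc t)) (x t)" and ?V = "unit_ball_vol (real d)"
  let ?I = "indicator (origin_ball d R) :: point \<Rightarrow> real"
  have "?L / sqrt d * (?V * (1 / sqrt d) ^ d / 2)
      = (\<Sum>t<N. edist d (x (Suc t)) (x t) / sqrt d * (measure (leb d) (origin_ball d (1 / sqrt d)) / 2))"
    using d_pos by (subst measure_origin_ball) (auto simp: sum_divide_distrib sum_distrib_right)
  also have "\<dots> \<le> (\<Sum>t<N. \<integral>\<eta>. ?I \<eta> * (low (Suc t) \<eta> - low t \<eta>) \<partial>leb d)"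
    by (intro sum_mono step_bound) auto
  also have "\<dots> = (\<integral>\<eta>. (\<Sum>t<N. ?I \<eta> * (low (Suc t) \<eta> - low t \<eta>)) \<partial>leb d)"
    by (intro Bochner_Integration.integral_sum[symmetric] integrable_low_diff) auto
  also have "\<dots> = (\<integral>\<eta>. ?I \<eta> * (low N \<eta> - low 0 \<eta>) \<partial>leb d)"
    using sum_lessThan_telescope[of "\<lambda>t. low t _" N] by (simp flip: sum_distrib_left)
  also have "\<dots> \<le> (\<integral>\<eta>. ?I \<eta> * (R * edist d (x 0) (x N)) \<partial>leb d)"
  proof (rule integral_mono)
    fix \<eta>
    have "low N \<eta> - low 0 \<eta> \<le> R * edist d (x 0) (x N)" if "\<eta> \<in> origin_ball d R"
      by (rule order_trans[OF low_diff_le mult_right_mono])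
        (use that in \<open>auto simp: origin_ball_def edist_eq_nrm\<close>)
    then show "?I \<eta> * (low N \<eta> - low 0 \<eta>) \<le> ?I \<eta> * (R * edist d (x 0) (x N))"
      by (auto simp: indicator_def)
  qed (use integrable_bounded_on_origin_ball[OF _ origin_ball_sets order_refl, of "\<lambda>_. R * edist d (x 0) (x N)"]
      in \<open>auto intro: integrable_low_diff\<close>)
  also have "\<dots> = ?V * R ^ d * (R * edist d (x 0) (x N))"
    using sets.sets_into_space[OF origin_ball_sets, of d R]
    by (simp add: Int_absorb2 measure_origin_ball add_pos_nonneg)
  also have "\<dots> = ?V * (R ^ Suc d * edist d (x 0) (x N))"
    by simp
  also have "\<dots> \<le> ?V * (exp 5 * edist d (x 0) (x N))"
    using R_power_le by (intro mult_left_mono mult_right_mono) (auto simp: edist_eq_nrm)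
  finally have "?V * (?L / sqrt d * (1 / sqrt d) ^ d / 2) \<le> ?V * (exp 5 * edist d (x 0) (x N))"
    by (simp add: mult_ac)
  then have "?L / sqrt d * (1 / sqrt d) ^ d / 2 \<le> exp 5 * edist d (x 0) (x N)"
    by (subst (asm) mult_le_cancel_left_pos) auto
  then have "?L \<le> 2 * exp 5 * sqrt d ^ Suc d * edist d (x 0) (x N)"
    using d_pos by (simp add: field_simps)
  also have "sqrt d ^ Suc d = real d powr ((real d + 1) / 2)"
    using d_pos by (simp add: powr_half_sqrt[symmetric] powr_powr add_divide_distrib powr_add
        flip: powr_realpow)
  finally show ?thesis .
qed

end

section \<open>Projections and the greedy algorithm\<close>

text \<open>\<open>proj\<close> chooses a minimiser, so existence must come first: K is closed, and
  cutting it with a box around x makes it compact.\<close>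

lemma proj_nearest:
  assumes "convex_body d K"
  shows "proj d K x \<in> K" and "\<And>y. y \<in> K \<Longrightarrow> edist d x (proj d K x) \<le> edist d x y"
proof -
  obtain y0 where y0: "y0 \<in> K"
    using assms by (auto simp: convex_body_def)
  have K: "closed K" "\<And>y i. \<lbrakk>y \<in> K; d \<le> i\<rbrakk> \<Longrightarrow> y i = 0"
    using assms by (auto simp: convex_body_def closedin_Euclidean_space_iff topspace_Euclidean_space)
  define r where "r = edist d x y0"
  \<comment> \<open>The half-width is the distance to \<open>y0\<close>, so points of K outside the
    box are farther from x than \<open>y0\<close>. Coordinates from d on are 0 throughout K.\<close>
  define C where "C = {y. \<forall>i. (if i < d then x i - r else 0) \<le> y i
      \<and> y i \<le> (if i < d then x i + r else 0)} \<inter> K"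
  have in_C: "y \<in> C" if y: "y \<in> K" "edist d x y \<le> r" for y
  proof -
    have "\<bar>x i - y i\<bar> \<le> r" if "i < d" for i
      using member_le_L2_set[of "{..<d}" i "\<lambda>i. \<bar>x i - y i\<bar>"] that y(2)
      by (simp add: edist_def L2_set_def)
    then show ?thesis
      using K(2)[OF y(1)] y(1) by (fastforce simp: C_def abs_le_iff)
  qed
  have "compact C"
    unfolding C_def using compact_box K(1) by (rule compact_Int_closed)
  moreover have "C \<noteq> {}"
    using in_C[OF y0] by (auto simp: r_def)
  moreover have "continuous_on C (edist d x)"
    unfolding edist_eq_nrm
    by (intro continuous_intros continuous_on_subset[OF continuous_on_product_coordinates]) auto
  ultimately obtain z where z: "z \<in> C" "\<And>y. y \<in> C \<Longrightarrow> edist d x z \<le> edist d x y"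
    using continuous_attains_inf[of C "edist d x"] by metis
  have "edist d x z \<le> edist d x y" if "y \<in> K" for y
    using z(2)[OF in_C[OF that]] z(2)[OF in_C[OF y0]] by (cases "edist d x y \<le> r") (auto simp: r_def)
  then have "is_arg_min (edist d x) (\<lambda>y. y \<in> K) z"
    using z(1) by (auto simp: is_arg_min_linorder C_def)
  then have "is_arg_min (edist d x) (\<lambda>y. y \<in> K) (proj d K x)"
    unfolding proj_def arg_min_on_def arg_min_def by (rule someI[of "is_arg_min _ _"])
  then show "proj d K x \<in> K" "\<And>y. y \<in> K \<Longrightarrow> edist d x (proj d K x) \<le> edist d x y"
    by (auto simp: is_arg_min_linorder)
qed

text \<open>Moving from the projection towards y stays in K and cannot bring it closer to x, so the
  first-order condition applies.\<close>

lemma proj_obtuse: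
  assumes "convex_body d K" "y \<in> K"
  shows "ip d (\<lambda>i. x i - proj d K x i) (\<lambda>i. y i - proj d K x i) \<le> 0"
proof -
  let ?p = "proj d K x"
  have "0 \<le> ip d (\<lambda>i. ?p i - x i) (\<lambda>i. y i - ?p i)"
  proof (rule ip_nonneg_if_norm_minimal)
    fix t :: real assume t: "0 < t" "t \<le> 1"
    have "(\<lambda>i. (1 - t) * ?p i + t * y i) \<in> K"
      using assms t proj_nearest(1)[OF assms(1)] by (simp add: convex_body_def convex_set_def)
    then have "edist d ?p x \<le> edist d (\<lambda>i. (1 - t) * ?p i + t * y i) x"
      unfolding edist_commute[of d _ x] by (rule proj_nearest(2)[OF assms(1)])
    then show "nrm d (\<lambda>i. ?p i - x i) \<le> nrm d (\<lambda>i. ?p i - x i + t * (y i - ?p i))"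
      by (simp add: edist_eq_nrm algebra_simps)
  qed
  then show ?thesis
    by (simp add: ip_linear)
qed

lemma position_greedy_Suc:
  assumes "t < length Ks"
  shows "position (greedy d) x0 Ks (Suc t) = proj d (Ks ! t) (position (greedy d) x0 Ks t)"
  using assms by (simp add: position_def greedy_def take_Suc_conv_app_nth)

lemma greedy_position_in_earlier:
  assumes "nested_instance d Ks" "t < u" "u \<le> length Ks"
  shows "position (greedy d) x0 Ks u \<in> Ks ! t"
proof -
  obtain v where v: "u = Suc v"
    using assms(2) by (cases u) auto
  have "convex_body d (Ks ! v)"
    using assms v by (auto simp: nested_instance_def)
  then have "position (greedy d) x0 Ks u \<in> Ks ! v"
    using assms v by (simp add: position_greedy_Suc proj_nearest(1))
  moreover have "Ks ! v \<subseteq> Ks ! t"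
  proof (cases "t = v")
    case False
    then show ?thesis
      using assms v by (auto simp: nested_instance_def sorted_wrt_iff_nth_less)
  qed simp
  ultimately show ?thesis
    by blast
qed

text \<open>The step leaving position t projects onto \<open>Ks ! t\<close>, which contains all
  later positions.\<close>

lemma greedy_walk_position:
  assumes "d \<ge> 1" "nested_instance d Ks"
  shows "greedy_walk d (position (greedy d) x0 Ks) (length Ks)"
proof
  fix t u assume tu: "t < u" "u \<le> length Ks"
  then have "convex_body d (Ks ! t)"
    using assms(2) by (auto simp: nested_instance_def)
  then show "ip d (\<lambda>i. position (greedy d) x0 Ks t i - position (greedy d) x0 Ks (Suc t) i)
      (\<lambda>i. position (greedy d) x0 Ks u i - position (greedy d) x0 Ks (Suc t) i) \<le> 0"
    using proj_obtuse greedy_position_in_earlier[OF assms(2) tu] tu by (simp add: position_greedy_Suc)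
qed (rule assms(1))

text \<open>The obtuse-angle argument again, for a point of the final body: it lies in every
  request, so no projection moves away from it. Offline points need not lie on the walk.\<close>

lemma greedy_edist_antimono:
  assumes "nested_instance d Ks" "y \<in> last Ks" "t \<le> length Ks"
  shows "edist d (position (greedy d) x0 Ks t) y \<le> edist d x0 y"
  using assms(3)
proof (induction t)
  case 0
  then show ?case
    by (simp add: position_def)
next
  case (Suc t)
  let ?x = "position (greedy d) x0 Ks t" and ?p = "position (greedy d) x0 Ks (Suc t)"
  have K: "convex_body d (Ks ! t)"
    using assms(1) Suc.prems by (auto simp: nested_instance_def)
  have "last Ks \<subseteq> Ks ! t"
  proof (cases "t = length Ks - 1")
    case True
    then show ?thesis
      using assms(1) by (simp add: nested_instance_def last_conv_nth)
  next
    case False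
    then show ?thesis
      using assms(1) Suc.prems by (auto simp: nested_instance_def last_conv_nth sorted_wrt_iff_nth_less)
  qed
  then have "ip d (\<lambda>i. ?x i - ?p i) (\<lambda>i. y i - ?p i) \<le> 0"
    using proj_obtuse[OF K] assms(2) Suc.prems by (auto simp: position_greedy_Suc)
  then have "(edist d ?p y)\<^sup>2 \<le> (edist d ?x y)\<^sup>2"
    using ip_nonneg[of d "\<lambda>i. ?x i - ?p i"]
    by (simp add: edist_square ip_linear ip_commute[of d ?p ?x] ip_commute[of d ?p y])
  then have "edist d ?p y \<le> edist d ?x y"
    by (rule power2_le_imp_le) (simp add: edist_eq_nrm)
  then show ?case
    using Suc by simp
qed

theorem theorem3:
  shows "\<exists>c :: nat \<Rightarrow> real.
           c \<in> O(\<lambda>d. real d powr ((real d + 1) / 2)) \<and>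
           (\<forall>d\<ge>1. competitive d (c d) (greedy d))"
proof (intro exI conjI allI impI)
  \<comment> \<open>Twice the constant of \<open>length_le\<close>: the end-to-end distance is at
    most twice the optimum, by the triangle inequality through an offline point.\<close>
  let ?c = "\<lambda>d. 4 * exp 5 * real d powr ((real d + 1) / 2)"
  show "?c \<in> O(\<lambda>d. real d powr ((real d + 1) / 2))"
    by simp
  fix d :: nat assume d: "d \<ge> 1"
  show "competitive d (?c d) (greedy d)"
    unfolding competitive_def
  proof (intro ballI allI impI conjI)
    fix x0 Ks t assume Ks: "nested_instance d Ks" and t: "t \<in> {1..length Ks}"
    then show "position (greedy d) x0 Ks t \<in> Ks ! (t - 1)"
      by (intro greedy_position_in_earlier) auto
  next
    fix x0 Ks assume Ks: "nested_instance d Ks"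
    let ?x = "position (greedy d) x0 Ks" and ?N = "length Ks"
    have c_pos: "?c d > 0"
      using d by simp
    have "cost d (greedy d) x0 Ks = (\<Sum>t<?N. edist d (?x (Suc t)) (?x t))"
      unfolding cost_def by (rule sum.reindex_bij_witness[of _ Suc "\<lambda>t. t - 1"]) auto
    also have "\<dots> \<le> ?c d / 2 * edist d (?x 0) (?x ?N)"
      using greedy_walk.length_le[OF greedy_walk_position[OF d Ks], of x0] by simp
    finally have cost: "cost d (greedy d) x0 Ks \<le> ?c d / 2 * edist d (?x 0) (?x ?N)" .
    \<comment> \<open>Dividing by the positive constant gives a lower bound on an infimum, provable
      one offline point at a time.\<close>
    have "cost d (greedy d) x0 Ks / ?c d \<le> opt_cost d x0 Ks"
      unfolding opt_cost_def
    proof (rule cINF_greatest)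
      have "last Ks \<in> set Ks"
        using Ks by (simp add: nested_instance_def)
      then show "last Ks \<noteq> {}"
        using Ks by (auto simp: nested_instance_def convex_body_def)
      fix y assume y: "y \<in> last Ks"
      have "edist d (?x 0) (?x ?N) \<le> edist d x0 y + edist d (?x ?N) y"
        using edist_triangle[of d x0 "?x ?N" y]
        by (simp add: position_def edist_commute)
      also have "\<dots> \<le> 2 * edist d x0 y"
        using greedy_edist_antimono[OF Ks y, of ?N x0] by simp
      finally have "?c d / 2 * edist d (?x 0) (?x ?N) \<le> ?c d / 2 * (2 * edist d x0 y)"
        using c_pos by (intro mult_left_mono) auto
      then have "cost d (greedy d) x0 Ks \<le> edist d x0 y * ?c d"
        using order_trans[OF cost] by (simp add: mult.commute)
      then show "cost d (greedy d) x0 Ks / ?c d \<le> edist d x0 y"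
        by (subst pos_divide_le_eq[OF c_pos])
    qed
    then show "cost d (greedy d) x0 Ks \<le> ?c d * opt_cost d x0 Ks"
      using pos_divide_le_eq[OF c_pos] by (simp add: mult.commute)
  qed
qed

end
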